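(* If $G$ is a randomly $k$-dimensional graph of order $n$ and diameter $d$, then $k\geq \frac{n-1}{d}$.
   Context: All graphs are finite, simple and connected; the diameter is the maximum distance between two vertices. For an ordered set $W=\{w_1,\dots,w_k\}\subseteq V(G)$ and $v\in V(G)$, $r(v|W)=(d(v,w_1),\dots,d(v,w_k))$, where $d$ denotes graph distance. $W$ is a resolving set if distinct vertices have distinct representations with respect to $W$; a basis is a minimum-size resolving set and its size is the metric dimension $\beta(G)$. $G$ is randomly $k$-dimensional if $\beta(G)=k$ and every $k$-subset of $V(G)$ is a basis of $G$. *)

theory Defs
  imports "Graph_Theory.Graph_Theory"
begin

text \<open>
  A finite simple undirected graph is a value satisfying the locale predicate \<^const>\<open>graph\<close>:
  each undirected edge is represented by its two opposite arcs.
\<close>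

definition gdist :: "('a, 'b) pre_digraph \<Rightarrow> 'a \<Rightarrow> 'a \<Rightarrow> nat" where
  "gdist G u v = (LEAST l. \<exists>p. pre_digraph.awalk G u p v \<and> length p = l)"

definition diameter :: "('a, 'b) pre_digraph \<Rightarrow> nat" where
  "diameter G = Max {gdist G u v | u v. u \<in> verts G \<and> v \<in> verts G}"

text \<open>An ordered set of vertices is a list without repetitions.\<close>

definition rep :: "('a, 'b) pre_digraph \<Rightarrow> 'a \<Rightarrow> 'a list \<Rightarrow> nat list" where
  "rep G v ws = map (gdist G v) ws"

text \<open>
  Being resolving does not depend on the chosen ordering, see \<open>resolving_set_any_order\<close> below.
\<close>

definition resolving_set :: "('a, 'b) pre_digraph \<Rightarrow> 'a set \<Rightarrow> bool" where
  "resolving_set G W \<longleftrightarrow> W \<subseteq> verts G \<and>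
     (\<exists>ws. distinct ws \<and> set ws = W \<and> inj_on (\<lambda>v. rep G v ws) (verts G))"

definition basis :: "('a, 'b) pre_digraph \<Rightarrow> 'a set \<Rightarrow> bool" where
  "basis G W \<longleftrightarrow> is_arg_min card (resolving_set G) W"

definition metric_dimension :: "('a, 'b) pre_digraph \<Rightarrow> nat" where
  "metric_dimension G = Min (card ` {W. resolving_set G W})"

definition randomly_dimensional :: "nat \<Rightarrow> ('a, 'b) pre_digraph \<Rightarrow> bool" where
  "randomly_dimensional k G \<longleftrightarrow> metric_dimension G = k \<and>
     (\<forall>W. W \<subseteq> verts G \<and> card W = k \<longrightarrow> basis G W)"

lemma resolving_set_any_order:
  assumes "resolving_set G W" and "set ws = W"
  shows "inj_on (\<lambda>v. rep G v ws) (verts G)"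
proof -
  obtain us where us: "set us = W" "inj_on (\<lambda>v. rep G v us) (verts G)"
    using assms(1) unfolding resolving_set_def by blast
  have "rep G u ws = rep G v ws \<longleftrightarrow> rep G u us = rep G v us" for u v
    using us(1) assms(2) by (simp add: rep_def)
  then show ?thesis
    using us(2) unfolding inj_on_def by simp
qed

end

theory Submission
  imports Defs "HOL-Analysis.Convex"
begin

text \<open>
  Any two distinct vertices \<open>x\<close>, \<open>y\<close> are unresolved by at most \<open>k - 1\<close> vertices, for otherwise some
  \<open>k\<close> of them would not be a basis. Counting triples \<open>(w, x, y)\<close>, with \<open>w\<close> equidistant from \<open>x\<close> and
  \<open>y\<close>, both different from \<open>w\<close> but possibly equal to each other, gives at most \<open>k n (n - 1)\<close> of them.
  Conversely, the \<open>n - 1\<close> vertices other than \<open>w\<close> are spread over \<open>d\<close> distance classes, so by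
  Cauchy--Schwarz each \<open>w\<close> contributes at least \<open>(n - 1)\<^sup>2 / d\<close> triples.
\<close>

text \<open>The right-hand sum counts ordered pairs with equal image, diagonal included. It is the
  sum of the squared fibre sizes of \<open>f\<close>, while \<open>card A\<close> is the sum of the
  sizes themselves.\<close>

lemma card_squared_le_card_times_collisions:
  assumes "finite A" "finite B" "f ` A \<subseteq> B"
  shows "(card A)\<^sup>2 \<le> card B * (\<Sum>x\<in>A. card {y \<in> A. f y = f x})"
proof -
  define c where "c b = card {y \<in> A. f y = b}" for b
  have "card A = (\<Sum>b\<in>B. c b)"
    using sum.group[of A B f "\<lambda>_. 1::nat"] assms by (simp add: c_def)
  moreover have "(\<Sum>x\<in>A. card {y \<in> A. f y = f x}) = (\<Sum>b\<in>B. (c b)\<^sup>2)"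
  proof -
    have "(\<Sum>x\<in>A. c (f x)) = (\<Sum>b\<in>B. \<Sum>x\<in>{x \<in> A. f x = b}. c (f x))"
      using sum.group[of A B f "\<lambda>x. c (f x)"] assms by simp
    also have "\<dots> = (\<Sum>b\<in>B. (c b)\<^sup>2)"
      by (rule sum.cong) (auto simp: c_def power2_eq_square)
    finally show ?thesis by (simp add: c_def)
  qed
  moreover have "(\<Sum>b\<in>B. c b)\<^sup>2 \<le> card B * (\<Sum>b\<in>B. (c b)\<^sup>2)"
  proof -
    \<comment> \<open>Cauchy-Schwarz against the constant vector 1, whose squared norm is
      \<open>card B\<close>.\<close>
    have "(\<Sum>b\<in>B. 1 * real (c b))\<^sup>2 \<le> (\<Sum>b\<in>B. 1\<^sup>2) * (\<Sum>b\<in>B. (real (c b))\<^sup>2)"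
      by (rule Cauchy_Schwarz_ineq_sum)
    then have "real ((\<Sum>b\<in>B. c b)\<^sup>2) \<le> real (card B * (\<Sum>b\<in>B. (c b)\<^sup>2))"
      by simp
    then show ?thesis
      by (simp only: of_nat_le_iff)
  qed
  ultimately show ?thesis by simp
qed

text \<open>The double count with \<open>gdist\<close> abstracted to \<open>D\<close>: all that
  matters is which values coincide. Leaving out the value 0 gives \<open>d\<close> classes instead
  of \<open>d + 1\<close>.\<close>

lemma card_le_if_few_equidistant:
  fixes D :: "'a \<Rightarrow> 'a \<Rightarrow> nat"
  assumes fin: "finite V" and ne: "V \<noteq> {}"
    and range: "\<And>x w. x \<in> V \<Longrightarrow> w \<in> V \<Longrightarrow> x \<noteq> w \<Longrightarrow> D x w \<in> {1..d}"
    and few: "\<And>x y. x \<in> V \<Longrightarrow> y \<in> V \<Longrightarrow> x \<noteq> y \<Longrightarrow> card {w \<in> V. D x w = D y w} < k"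
  shows "card V - 1 \<le> d * k"
proof -
  define m where "m = card V - 1"
  define S where "S w = (\<Sum>x\<in>V - {w}. card {y \<in> V - {w}. D y w = D x w})" for w
  have lower: "m\<^sup>2 \<le> d * S w" if "w \<in> V" for w
    using card_squared_le_card_times_collisions[of "V - {w}" "{1..d}" "\<lambda>x. D x w"] that fin range
    by (fastforce simp: S_def m_def)
  \<comment> \<open>The diagonal \<open>y = x\<close> accounts for the summand \<open>m\<close>. The
    remaining pairs may now involve \<open>w\<close> itself, which only enlarges the count and makes
    the ranges of \<open>x\<close> and \<open>y\<close> independent of \<open>w\<close>, so that the
    sums can be exchanged.\<close>
  have split: "S w \<le> m + (\<Sum>x\<in>V. \<Sum>y\<in>V - {x}. if D y w = D x w then 1 else 0)" if "w \<in> V" for w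
  proof -
    have "card {y \<in> V - {w}. D y w = D x w} \<le> 1 + (\<Sum>y\<in>V - {x}. if D y w = D x w then 1 else 0)"
      if "x \<in> V" for x
    proof -
      have "{y \<in> V - {w}. D y w = D x w} \<subseteq> insert x {y \<in> V - {x}. D y w = D x w}"
        by auto
      then have "card {y \<in> V - {w}. D y w = D x w} \<le> card (insert x {y \<in> V - {x}. D y w = D x w})"
        using fin by (intro card_mono) auto
      also have "\<dots> = 1 + card {y \<in> V - {x}. D y w = D x w}"
        using fin by simp
      finally show ?thesis
        using fin by (simp add: sum.If_cases Int_def)
    qed
    then have "S w \<le> (\<Sum>x\<in>V - {w}. 1 + (\<Sum>y\<in>V - {x}. if D y w = D x w then 1 else 0))"
      unfolding S_def by (intro sum_mono) auto
    also have "\<dots> = m + (\<Sum>x\<in>V - {w}. \<Sum>y\<in>V - {x}. if D y w = D x w then 1 else 0)"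
      unfolding sum.distrib using fin that by (simp add: m_def)
    also have "\<dots> \<le> m + (\<Sum>x\<in>V. \<Sum>y\<in>V - {x}. if D y w = D x w then 1 else 0)"
      using fin by (intro add_left_mono sum_mono2) auto
    finally show ?thesis .
  qed
  have upper: "(\<Sum>w\<in>V. S w) \<le> card V * (m * k)"
  \<comment> \<open>On a single point \<open>few\<close> is vacuous and \<open>k\<close> may be 0;
    otherwise two distinct points force \<open>k \<ge> 1\<close>, so that \<open>k - 1\<close> is
    not truncated.\<close>
  proof (cases "m = 0")
    case True
    then have "V - {w} = {}" if "w \<in> V" for w
      using that fin by (metis card_Diff_singleton card_0_eq finite_Diff m_def)
    then have "S w = 0" if "w \<in> V" for w
      using that by (simp only: S_def sum.empty)
    then show ?thesis by simp
  next
    case False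
    then have "card V \<noteq> 1" "card V \<noteq> 0" by (auto simp: m_def)
    then have "\<exists>x\<in>V. \<exists>y\<in>V. x \<noteq> y"
      by (metis card_1_singletonE fin is_singletonI' is_singleton_altdef ne)
    then have k: "k \<ge> 1" using few by fastforce
    have "(\<Sum>w\<in>V. S w)
        \<le> (\<Sum>w\<in>V. m + (\<Sum>x\<in>V. \<Sum>y\<in>V - {x}. if D y w = D x w then 1 else 0))"
      by (intro sum_mono split)
    also have "\<dots> = card V * m
        + (\<Sum>x\<in>V. \<Sum>y\<in>V - {x}. \<Sum>w\<in>V. if D y w = D x w then 1 else 0)"
    proof -
      have "(\<Sum>w\<in>V. \<Sum>x\<in>V. \<Sum>y\<in>V - {x}. if D y w = D x w then 1 else 0)
          = (\<Sum>x\<in>V. \<Sum>w\<in>V. \<Sum>y\<in>V - {x}. if D y w = D x w then 1 else 0 :: nat)"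
        by (rule sum.swap)
      also have "\<dots> = (\<Sum>x\<in>V. \<Sum>y\<in>V - {x}. \<Sum>w\<in>V. if D y w = D x w then 1 else 0)"
        by (rule sum.cong[OF refl]) (rule sum.swap)
      finally show ?thesis
        unfolding sum.distrib by simp
    qed
    \<comment> \<open>With \<open>w\<close> innermost, each sum counts the points equidistant from a
      fixed pair \<open>x\<close>, \<open>y\<close>.\<close>
    also have "\<dots> \<le> card V * m + (\<Sum>x\<in>V. \<Sum>y\<in>V - {x}. k - 1)"
    proof (intro add_left_mono sum_mono)
      fix x y assume "x \<in> V" "y \<in> V - {x}"
      then have "card {w \<in> V. D y w = D x w} < k" using few[of y x] by auto
      then show "(\<Sum>w\<in>V. if D y w = D x w then 1 else 0) \<le> k - 1"
        using fin by (simp add: sum.If_cases Int_def)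
    qed
    also have "\<dots> = card V * m + card V * (m * (k - 1))"
      using fin by (simp add: m_def)
    also have "\<dots> = card V * (m * k)"
      using k by (cases k) (auto simp: algebra_simps)
    finally show ?thesis .
  qed
  have "card V * m\<^sup>2 = (\<Sum>w\<in>V. m\<^sup>2)" by simp
  also have "\<dots> \<le> (\<Sum>w\<in>V. d * S w)" by (intro sum_mono lower)
  also have "\<dots> \<le> d * (card V * (m * k))"
    using upper by (simp add: sum_distrib_left[symmetric])
  \<comment> \<open>Grouped so that the common factor \<open>card V * m\<close> cancels when
    \<open>m\<close> is positive.\<close>
  finally have "(card V * m) * m \<le> (card V * m) * (d * k)"
    by (simp add: power2_eq_square algebra_simps)
  moreover have "card V > 0" using fin ne by (simp add: card_gt_0_iff)
  ultimately show ?thesis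
    unfolding m_def[symmetric] by (cases "m = 0") auto
qed

lemma (in graph) gdist_pos:
  assumes "Digraph_Component.connected G" "u \<in> verts G" "v \<in> verts G" "u \<noteq> v"
  shows "gdist G u v \<ge> 1"
proof -
  \<comment> \<open>Some walk exists, so the \<open>LEAST\<close> in \<open>gdist\<close> is
    attained; a walk of length 0 would give \<open>u = v\<close>.\<close>
  have "u \<rightarrow>\<^sup>*\<^bsub>G\<^esub> v"
    using symmetric_connected_imp_strongly_connected[OF sym_arcs assms(1)] assms(2,3) by auto
  then have "\<exists>l p. awalk u p v \<and> length p = l"
    by (simp add: reachable_awalk)
  then have "\<exists>p. awalk u p v \<and> length p = gdist G u v"
    unfolding gdist_def by (rule LeastI_ex)
  then show ?thesis
    using assms(4) by (cases "gdist G u v") (auto simp: awalk_Nil_iff)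
qed

lemma gdist_le_diameter:
  assumes "finite (verts G)" "u \<in> verts G" "v \<in> verts G"
  shows "gdist G u v \<le> diameter G"
  unfolding diameter_def
proof (rule Max_ge)
  have "{gdist G u v | u v. u \<in> verts G \<and> v \<in> verts G}
      = (\<lambda>(u, v). gdist G u v) ` (verts G \<times> verts G)"
    by auto
  then show "finite {gdist G u v | u v. u \<in> verts G \<and> v \<in> verts G}"
    using assms(1) by simp
qed (use assms in auto)

lemma randomly_dimensional_card_unresolving_less:
  assumes "randomly_dimensional k G" "x \<in> verts G" "y \<in> verts G" "x \<noteq> y"
  shows "card {w \<in> verts G. gdist G x w = gdist G y w} < k"
proof (rule ccontr)
  assume "\<not> ?thesis"
  then obtain W where W: "W \<subseteq> {w \<in> verts G. gdist G x w = gdist G y w}" "card W = k"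
    by (meson not_less obtain_subset_with_card_n)
  then have "basis G W"
    using assms(1) by (auto simp: randomly_dimensional_def)
  then have "resolving_set G W"
    by (simp add: basis_def is_arg_min_def)
  then obtain ws where ws: "set ws = W" "inj_on (\<lambda>v. rep G v ws) (verts G)"
    unfolding resolving_set_def by blast
  moreover have "rep G x ws = rep G y ws"
    using W ws(1) by (auto simp: rep_def)
  ultimately show False
    using assms(2-4) by (auto dest: inj_onD)
qed

theorem mainTheorem3:
  fixes G :: "('a, 'b) pre_digraph" and n k d :: nat
  assumes "graph G" and "Digraph_Component.connected G"
    and "randomly_dimensional k G"
    and "card (verts G) = n" and "diameter G = d"
  shows "real k \<ge> (real n - 1) / real d"
proof -
  interpret graph G by fact
  have ne: "verts G \<noteq> {}"
    using assms(2) by (auto simp: Digraph_Component.connected_def strongly_connected_def)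
  have "n - 1 \<le> d * k"
    unfolding assms(4)[symmetric]
  proof (rule card_le_if_few_equidistant[where D = "gdist G"])
    show "gdist G x w \<in> {1..d}" if "x \<in> verts G" "w \<in> verts G" "x \<noteq> w" for x w
      using gdist_pos[OF assms(2) that] gdist_le_diameter[of G x w] that assms(5) by auto
  qed (use ne randomly_dimensional_card_unresolving_less[OF assms(3)] in auto)
  moreover have "n \<ge> 1"
    using ne unfolding assms(4)[symmetric] by (simp add: Suc_le_eq card_gt_0_iff)
  ultimately have "real n - 1 \<le> real k * real d"
    by (metis (no_types, opaque_lifting) mult.commute of_nat_1 of_nat_diff of_nat_le_iff of_nat_mult)
  then show ?thesis
    \<comment> \<open>For \<open>d = 0\<close> the quotient is 0 by the convention for division by
      zero.\<close>
    by (cases "d = 0") (auto simp: pos_divide_le_eq)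
qed

end
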